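(* Let $H$ be a complex Hilbert space, let $R_0\in B(H)_+$, and let $(u_n)_{n\ge 0}\subset H$ be a sequence of unit vectors. Define $R_{n+1}=\Phi_{u_n}(R_n)=R_n^{1/2}(I-|u_n\rangle\langle u_n|)R_n^{1/2}$ and $E_n=R_n^{1/2}u_n$ for $n\ge 0$, and let $R_\infty$ be the strong operator limit of $(R_n)$. Set $\mathcal{K}:=\overline{\operatorname{ran}}(R_0^{1/2})$ and $\mathcal{E}:=\overline{\operatorname{span}}\{E_n:n\ge 0\}\subset H$. Then the following are equivalent: (1) $R_\infty=0$. (2) For every $x\in H$, $\sum_{n=0}^\infty|\langle E_n,x\rangle|^2=\langle x,R_0x\rangle$. (3) $\mathcal{E}=\mathcal{K}$ and, for every $x\in\mathcal{K}$, $\sum_{n=0}^\infty|\langle E_n,x\rangle|^2=\langle x,R_0x\rangle$. In particular, when $R_\infty=0$, the family $(E_n)_{n\ge 0}$ is complete in $\mathcal{K}$ (its closed linear span is $\mathcal{K}$), and the frame operator of $(E_n)$ coincides with $R_0$.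
   Context: $B(H)_+$ is the set of bounded positive operators on $H$. Inner products are linear in the second variable. $|a\rangle\langle b|$ denotes the operator $x\mapsto\langle b,x\rangle a$. For a unit vector $u$ and $R\in B(H)_+$, $\Phi_u(R)=R^{1/2}(I-|u\rangle\langle u|)R^{1/2}\in B(H)_+$. The sequence $(R_n)$ is decreasing in the Löwner order and bounded below by $0$, so it converges in the strong operator topology to some $R_\infty\in B(H)_+$ (if some $R_n=0$, then $R_k=0$ for all $k\ge n$). The frame operator of $(E_n)$ is $S=T^*T=\sum_{n=0}^\infty|E_n\rangle\langle E_n|$ (strong operator convergence), where $T:H\to\ell^2(\mathbb{N})$, $Tx=(\langle E_n,x\rangle)_{n\ge 0}$, is the (bounded) analysis operator. *)

theory Defs
  imports "HOL-Analysis.Analysis"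
begin

section \<open>Complex Hilbert spaces\<close>

text \<open>
  The underlying real inner product space is that of the real part of the complex inner
  product, so norm, topology and completeness are the library's. The complex inner product is
  linear in the second argument. Completeness is added by the class banach; there is
  no restriction on the dimension.
\<close>

class complex_inner = real_inner +
  fixes scaleC :: "complex \<Rightarrow> 'a \<Rightarrow> 'a" (infixr "*\<^sub>C" 75)
    and cinner :: "'a \<Rightarrow> 'a \<Rightarrow> complex"
  assumes scaleC_add_right: "a *\<^sub>C (x + y) = a *\<^sub>C x + a *\<^sub>C y"
    and scaleC_add_left: "(a + b) *\<^sub>C x = a *\<^sub>C x + b *\<^sub>C x"
    and scaleC_scaleC: "a *\<^sub>C (b *\<^sub>C x) = (a * b) *\<^sub>C x"
    and scaleC_one: "1 *\<^sub>C x = x"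
    and scaleC_of_real: "complex_of_real r *\<^sub>C x = r *\<^sub>R x"
    and cinner_commute: "cinner x y = cnj (cinner y x)"
    and cinner_add_right: "cinner x (y + z) = cinner x y + cinner x z"
    and cinner_scaleC_right: "cinner x (a *\<^sub>C y) = a * cinner x y"
    and Re_cinner: "Re (cinner x y) = inner x y"

class complex_hilbert = complex_inner + banach

instantiation complex :: complex_hilbert
begin

definition scaleC_complex :: "complex \<Rightarrow> complex \<Rightarrow> complex"
  where "scaleC_complex a x = a * x"

definition cinner_complex :: "complex \<Rightarrow> complex \<Rightarrow> complex"
  where "cinner_complex x y = cnj x * y"

instance
  by standard
    (simp_all add: scaleC_complex_def cinner_complex_def inner_complex_def
      scaleR_conv_of_real algebra_simps)

end

global_interpretation complex_vector: vector_space "scaleC :: complex \<Rightarrow> 'a \<Rightarrow> 'a::complex_inner"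
  defines cspan = "complex_vector.span"
  by standard (simp_all add: scaleC_add_right scaleC_add_left scaleC_scaleC scaleC_one)


section \<open>Bounded operators\<close>

definition bounded_clinear :: "('a::complex_inner \<Rightarrow> 'a) \<Rightarrow> bool"
  where "bounded_clinear A \<longleftrightarrow> bounded_linear A \<and> (\<forall>c x. A (c *\<^sub>C x) = c *\<^sub>C A x)"

definition positive_op :: "('a::complex_inner \<Rightarrow> 'a) \<Rightarrow> bool"
  where "positive_op A \<longleftrightarrow> bounded_clinear A \<and> (\<forall>x. cinner x (A x) \<in> \<real>\<^sub>\<ge>\<^sub>0)"

definition op_sqrt :: "('a::complex_inner \<Rightarrow> 'a) \<Rightarrow> 'a \<Rightarrow> 'a"
  where "op_sqrt A = (THE B. positive_op B \<and> B \<circ> B = A)"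

definition ketbra :: "'a::complex_inner \<Rightarrow> 'a \<Rightarrow> 'a \<Rightarrow> 'a"
  where "ketbra a b = (\<lambda>x. cinner b x *\<^sub>C a)"

definition Phi :: "'a::complex_inner \<Rightarrow> ('a \<Rightarrow> 'a) \<Rightarrow> 'a \<Rightarrow> 'a"
  where "Phi v A = op_sqrt A \<circ> (\<lambda>x. x - ketbra v v x) \<circ> op_sqrt A"

definition sot_tendsto :: "(nat \<Rightarrow> 'a::complex_inner \<Rightarrow> 'a) \<Rightarrow> ('a \<Rightarrow> 'a) \<Rightarrow> bool"
  where "sot_tendsto A L \<longleftrightarrow> bounded_clinear L \<and> (\<forall>x. (\<lambda>n. A n x) \<longlonglongrightarrow> L x)"

definition sot_lim :: "(nat \<Rightarrow> 'a::complex_inner \<Rightarrow> 'a) \<Rightarrow> 'a \<Rightarrow> 'a"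
  where "sot_lim A = (THE L. sot_tendsto A L)"


section \<open>Frame operators\<close>

text \<open>The analysis operator, mapping x to the coefficient sequence of all cinner (E n) x,
  is a bounded operator into the square-summable sequences.\<close>

definition bessel_sequence :: "(nat \<Rightarrow> 'a::complex_inner) \<Rightarrow> bool"
  where "bessel_sequence E \<longleftrightarrow>
    (\<exists>B. \<forall>x. summable (\<lambda>n. (cmod (cinner (E n) x))\<^sup>2) \<and>
             (\<Sum>n. (cmod (cinner (E n) x))\<^sup>2) \<le> B * (norm x)\<^sup>2)"

text \<open>The frame operator as the strong operator sum of the rank-one operators; it is
  meaningful for Bessel sequences.\<close>

definition frame_operator :: "(nat \<Rightarrow> 'a::complex_inner) \<Rightarrow> 'a \<Rightarrow> 'a"
  where "frame_operator E = sot_lim (\<lambda>N x. \<Sum>n<N. ketbra (E n) (E n) x)"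

end

theory Submission
  imports Defs
begin

text \<open>
  Since \<open>A\<^sup>1\<^sup>/\<^sup>2 (I - |v\<rangle>\<langle>v|) A\<^sup>1\<^sup>/\<^sup>2 = A - |A\<^sup>1\<^sup>/\<^sup>2 v\<rangle>\<langle>A\<^sup>1\<^sup>/\<^sup>2 v|\<close>, the recursion telescopes:
  \<open>R n = R 0 - \<Sum>k<n. |E k\<rangle>\<langle>E k|\<close>. Hence \<open>\<langle>x, R n x\<rangle>\<close> is the amount by which the \<open>n\<close>th partial sum
  falls short of \<open>\<langle>x, R 0 x\<rangle>\<close>. These numbers decrease and are nonnegative, and a positive operator
  \<open>D \<le> M I\<close> satisfies \<open>\<parallel>D x\<parallel>\<^sup>2 \<le> M \<langle>x, D x\<rangle>\<close> (\<open>pos_symmetric_norm_square_le\<close>). So \<open>R n\<close> converges strongly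
  (\<open>sot_tendsto_R\<close>), and its limit \<open>L\<close> satisfies \<open>L x = 0\<close> exactly when the sum formula holds
  at \<open>x\<close> (\<open>sot_lim_eq_0_iff\<close>).

  For the span, the essential fact is that the range of \<open>A\<^sup>1\<^sup>/\<^sup>2\<close> lies in the closure of the range of
  \<open>A\<close>. By induction it places every \<open>R n x\<close> and every \<open>E n\<close> in \<open>\<K>\<close>, the closed range of the square
  root of \<open>R 0\<close>. If \<open>L = 0\<close>, then \<open>R 0 x = \<Sum>k. \<langle>E k, x\<rangle> E k\<close> lies in the closed span of the
  \<open>E n\<close>, and by the same fact so does all of \<open>\<K>\<close>. Conversely, suppose that \<open>L\<close> vanishes on \<open>\<K>\<close>.
  As \<open>L x\<close> itself lies in \<open>\<K>\<close>, symmetry gives \<open>\<parallel>L x\<parallel>\<^sup>2 = \<langle>L (L x), x\<rangle> = 0\<close> for every \<open>x\<close>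
  (\<open>sot_lim_eq_0_if_on_sqrt_range\<close>).

  Existence and uniqueness of the positive square root are proved along the way. The root is
  \<open>I - Y\<close>, up to scaling, where \<open>Y\<close> is the limit of the iteration \<open>Y \<mapsto> (I - A + Y\<^sup>2) / 2\<close>. The
  iteration converges in norm because the scalar iteration \<open>y \<mapsto> (1 + y\<^sup>2) / 2\<close> majorizes it, and
  the iterates show that the root commutes with everything that commutes with \<open>A\<close> and
  that its range lies in the closure of the range of \<open>A\<close> (\<open>pos_symmetric_sqrt_exists\<close>).
\<close>

section \<open>Positive forms\<close>

text \<open>
  Much of the argument uses only the real inner product, so it is carried out for
  operators that are symmetric and nonnegative over the reals. On a complex space this
  together with complex homogeneity amounts to positivity in the usual sense
  (\<open>positive_op_iff_pos_symmetric\<close>).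
\<close>

definition pos_symmetric :: "('a::real_inner \<Rightarrow> 'a) \<Rightarrow> bool"
  where "pos_symmetric A \<longleftrightarrow> bounded_linear A \<and>
    (\<forall>x y. inner x (A y) = inner (A x) y) \<and> (\<forall>x. 0 \<le> inner x (A x))"

lemma pos_symmetric_symD: "pos_symmetric A \<Longrightarrow> inner x (A y) = inner (A x) y"
  and pos_symmetric_posD: "pos_symmetric A \<Longrightarrow> 0 \<le> inner x (A x)"
  and pos_symmetric_linearD: "pos_symmetric A \<Longrightarrow> bounded_linear A"
  by (auto simp: pos_symmetric_def)

text \<open>
  Expand \<open>\<langle>z, D z\<rangle> \<ge> 0\<close> at \<open>z = x - D x / M\<close>, and bound the form at \<open>D x\<close> by the hypothesis. The
  estimate turns convergence of quadratic forms into norm convergence.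
\<close>

lemma pos_symmetric_norm_square_le:
  assumes D: "pos_symmetric D" and M: "M > 0"
    and le: "\<And>y. inner y (D y) \<le> M * (norm y)\<^sup>2"
  shows "(norm (D x))\<^sup>2 \<le> M * inner x (D x)"
proof -
  interpret bounded_linear D using D by (simp add: pos_symmetric_def)
  have sym: "inner a (D b) = inner (D a) b" for a b
    by (rule pos_symmetric_symD[OF D])
  let ?z = "x - (1 / M) *\<^sub>R D x"
  have "0 \<le> inner ?z (D ?z)" by (rule pos_symmetric_posD[OF D])
  also have "inner ?z (D ?z) =
      inner x (D x) - 2 / M * (norm (D x))\<^sup>2 + inner (D x) (D (D x)) / M\<^sup>2"
    by (simp add: diff scaleR inner_diff_left inner_diff_right sym[of x "D x"] inner_commute
        power2_norm_eq_inner power2_eq_square[of M] diff_divide_distrib)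
  also have "\<dots> \<le> inner x (D x) - 2 / M * (norm (D x))\<^sup>2 + (M * (norm (D x))\<^sup>2) / M\<^sup>2"
    using le[of "D x"] by (intro add_left_mono divide_right_mono) auto
  also have "\<dots> = inner x (D x) - (norm (D x))\<^sup>2 / M"
    using M by (simp add: field_simps power2_eq_square)
  finally show ?thesis using M by (simp add: field_simps)
qed

lemma pos_symmetric_form_bound:
  assumes "pos_symmetric A"
  obtains M where "M > 0" "\<And>x. norm (A x) \<le> M * norm x" "\<And>x. inner x (A x) \<le> M * (norm x)\<^sup>2"
proof -
  obtain M where M: "M > 0" "\<And>x. norm (A x) \<le> norm x * M"
    using bounded_linear.pos_bounded assms unfolding pos_symmetric_def by blast
  have "inner x (A x) \<le> M * (norm x)\<^sup>2" for x
  proof -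
    have "inner x (A x) \<le> norm x * norm (A x)" by (rule norm_cauchy_schwarz)
    also have "\<dots> \<le> norm x * (norm x * M)" by (intro mult_left_mono M) auto
    finally show ?thesis by (simp add: power2_eq_square mult_ac)
  qed
  with M show ?thesis by (intro that[of M]) (simp_all add: mult.commute)
qed

lemma pos_symmetric_form_zero:
  assumes "pos_symmetric A" "inner x (A x) = 0"
  shows "A x = 0"
proof -
  obtain M where "M > 0" "\<And>x. inner x (A x) \<le> M * (norm x)\<^sup>2"
    using pos_symmetric_form_bound[OF assms(1)] by metis
  from pos_symmetric_norm_square_le[OF assms(1) this, of x] assms(2) show ?thesis by simp
qed

section \<open>Square roots of positive operators\<close>

text \<open>
  With \<open>B = I - A\<close>, the operator \<open>S = I - Y\<close> satisfies \<open>S\<^sup>2 = A\<close> exactly when \<open>Y\<close> is a fixed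
  point of \<open>Y \<mapsto> (B + Y\<^sup>2) / 2\<close>; the iteration starts at \<open>0\<close>.
\<close>

primrec sqrt_iter :: "'a::real_normed_vector \<Rightarrow>\<^sub>L 'a \<Rightarrow> nat \<Rightarrow> 'a \<Rightarrow>\<^sub>L 'a"
  where "sqrt_iter B 0 = 0"
  | "sqrt_iter B (Suc n) = (1/2) *\<^sub>R (B + (sqrt_iter B n o\<^sub>L sqrt_iter B n))"

text \<open>
  The scalar iteration, for \<open>B = 1\<close>. It majorizes the operator iteration and its increments
  whenever the norm of \<open>B\<close> is at most \<open>1\<close>; since the scalars converge even in
  this extreme case, the operators converge in norm without \<open>A\<close> having to be invertible.
\<close>

primrec sqrt_iter_bound :: "nat \<Rightarrow> real"
  where "sqrt_iter_bound 0 = 0"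
  | "sqrt_iter_bound (Suc n) = (1 + (sqrt_iter_bound n)\<^sup>2) / 2"

lemma sqrt_iter_bound_range: "0 \<le> sqrt_iter_bound n \<and> sqrt_iter_bound n \<le> 1"
proof (induction n)
  case (Suc n)
  then have "(sqrt_iter_bound n)\<^sup>2 \<le> 1" by (simp add: power_le_one)
  then show ?case by simp
qed simp

lemma sqrt_iter_bound_mono: "sqrt_iter_bound n \<le> sqrt_iter_bound (Suc n)"
  using zero_le_power2[of "sqrt_iter_bound n - 1"] by (simp add: power2_diff)

lemma sqrt_iter_bound_tendsto: "sqrt_iter_bound \<longlonglongrightarrow> 1"
proof -
  have "incseq sqrt_iter_bound" by (intro incseq_SucI sqrt_iter_bound_mono)
  then obtain l where l: "sqrt_iter_bound \<longlonglongrightarrow> l"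
    using incseq_convergent[of sqrt_iter_bound 1] sqrt_iter_bound_range by metis
  have "(\<lambda>n. (1 + (sqrt_iter_bound n)\<^sup>2) / 2) \<longlonglongrightarrow> (1 + l\<^sup>2) / 2"
    by (intro tendsto_intros l) auto
  moreover have "(\<lambda>n. (1 + (sqrt_iter_bound n)\<^sup>2) / 2) \<longlonglongrightarrow> l"
    using LIMSEQ_Suc[OF l] by simp
  ultimately have "(1 + l\<^sup>2) / 2 = l" using LIMSEQ_unique by blast
  then have "(l - 1)\<^sup>2 = 0" by (simp add: power2_diff)
  then show ?thesis using l by simp
qed

lemma norm_sqrt_iter_le:
  assumes B: "norm B \<le> 1"
  shows "norm (sqrt_iter B n) \<le> sqrt_iter_bound n"
proof (induction n)
  case (Suc n)
  let ?Y = "sqrt_iter B n"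
  have "norm (?Y o\<^sub>L ?Y) \<le> norm ?Y * norm ?Y" by (rule norm_blinfun_compose)
  also have "\<dots> \<le> (sqrt_iter_bound n)\<^sup>2"
    unfolding power2_eq_square using Suc sqrt_iter_bound_range by (intro mult_mono) auto
  finally have "norm (B + (?Y o\<^sub>L ?Y)) \<le> 1 + (sqrt_iter_bound n)\<^sup>2"
    using B norm_triangle_ineq[of B "?Y o\<^sub>L ?Y"] by linarith
  then show ?case by simp
qed simp

text \<open>
  The identity \<open>Z\<^sup>2 - Y\<^sup>2 = Z (Z - Y) + (Z - Y) Y\<close> holds without commutativity, and
  for scalars it gives exactly the increment of the majorant.
\<close>

lemma norm_sqrt_iter_diff_le:
  assumes B: "norm B \<le> 1"
  shows "norm (sqrt_iter B (Suc n) - sqrt_iter B n) \<le> sqrt_iter_bound (Suc n) - sqrt_iter_bound n"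
proof (induction n)
  case 0
  then show ?case using B by simp
next
  case (Suc n)
  define Y Z y z where "Y = sqrt_iter B n" and "Z = sqrt_iter B (Suc n)"
    and "y = sqrt_iter_bound n" and "z = sqrt_iter_bound (Suc n)"
  note defs = this
  have YZ: "norm Y \<le> y" "norm Z \<le> z" "norm (Z - Y) \<le> z - y"
    unfolding defs by (rule norm_sqrt_iter_le[OF B] Suc)+
  have nonneg: "0 \<le> y" "0 \<le> z" "0 \<le> z - y"
    unfolding defs using sqrt_iter_bound_range sqrt_iter_bound_mono by (auto simp del: sqrt_iter_bound.simps)
  have Z: "Z = (1/2) *\<^sub>R (B + (Y o\<^sub>L Y))" and z: "z = (1 + y\<^sup>2) / 2"
    by (simp_all add: defs)
  have "sqrt_iter B (Suc (Suc n)) = (1/2) *\<^sub>R (B + (Z o\<^sub>L Z))"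
    unfolding defs by (rule sqrt_iter.simps)
  moreover have "(1/2) *\<^sub>R (B + (Z o\<^sub>L Z)) - (1/2) *\<^sub>R (B + (Y o\<^sub>L Y))
      = (1/2) *\<^sub>R ((Z o\<^sub>L (Z - Y)) + ((Z - Y) o\<^sub>L Y))"
    by (rule blinfun_eqI) (simp add: blinfun.bilinear_simps algebra_simps)
  ultimately have "norm (sqrt_iter B (Suc (Suc n)) - Z) = norm ((Z o\<^sub>L (Z - Y)) + ((Z - Y) o\<^sub>L Y)) / 2"
    using Z by simp
  also have "\<dots> \<le> (norm Z * norm (Z - Y) + norm (Z - Y) * norm Y) / 2"
    by (intro divide_right_mono norm_triangle_le add_mono norm_blinfun_compose) simp
  also have "\<dots> \<le> (z * (z - y) + (z - y) * y) / 2"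
    using nonneg YZ by (intro divide_right_mono add_mono mult_mono) auto
  also have "\<dots> = (1 + z\<^sup>2) / 2 - (1 + y\<^sup>2) / 2"
    by (simp add: field_simps power2_eq_square)
  also have "\<dots> = sqrt_iter_bound (Suc (Suc n)) - z"
    using z by (simp add: defs)
  finally show ?case unfolding defs .
qed

lemma sqrt_iter_convergent:
  fixes B :: "'a::{real_normed_vector,banach} \<Rightarrow>\<^sub>L 'a"
  assumes "norm B \<le> 1"
  shows "convergent (sqrt_iter B)"
proof -
  have "summable (\<lambda>n. sqrt_iter_bound (Suc n) - sqrt_iter_bound n)"
    by (rule telescope_summable[OF sqrt_iter_bound_tendsto])
  then have "summable (\<lambda>n. sqrt_iter B (Suc n) - sqrt_iter B n)"
    by (rule summable_comparison_test'[where N=0]) (rule norm_sqrt_iter_diff_le[OF assms])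
  then have "convergent (\<lambda>n. \<Sum>i<n. sqrt_iter B (Suc i) - sqrt_iter B i)"
    by (simp add: summable_iff_convergent)
  then show ?thesis by (simp only: sum_lessThan_telescope sqrt_iter.simps(1) diff_zero)
qed

lemma sqrt_iter_commute:
  fixes B :: "'a::real_normed_vector \<Rightarrow>\<^sub>L 'a"
  assumes T: "bounded_linear T" and TB: "\<And>x. T (B x) = B (T x)"
  shows "T (sqrt_iter B n x) = sqrt_iter B n (T x)"
proof -
  interpret T: bounded_linear T by fact
  show ?thesis
    by (induction n arbitrary: x) (simp_all add: T.zero T.scaleR T.add TB blinfun.bilinear_simps)
qed

lemma sqrt_iter_symmetric:
  fixes B :: "'a::real_inner \<Rightarrow>\<^sub>L 'a"
  assumes "\<And>x y. inner x (B y) = inner (B x) y"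
  shows "inner x (sqrt_iter B n y) = inner (sqrt_iter B n x) y"
  by (induction n arbitrary: x y)
     (simp_all add: assms blinfun.bilinear_simps inner_add_left inner_add_right)

text \<open>
  Both iterates are the same polynomial, evaluated at \<open>B = I - A\<close> and at \<open>B = I\<close>, so their
  difference is a multiple of \<open>A\<close>. As the scalar iterates tend to \<open>1\<close>, this places
  the range of the square root in the closure of the range of \<open>A\<close>.
\<close>

lemma sqrt_iter_range:
  fixes A :: "'a::real_inner \<Rightarrow>\<^sub>L 'a"
  shows "sqrt_iter_bound n *\<^sub>R x - sqrt_iter (id_blinfun - A) n x \<in> range A"
proof (induction n arbitrary: x)
  case 0
  then show ?case by (auto intro!: image_eqI[of _ _ 0])
next
  case (Suc n)
  let ?y = "sqrt_iter_bound n" and ?Y = "sqrt_iter (id_blinfun - A) n"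
  (* Factor y^2 - Y^2 as (y - Y) (y + Y); the induction hypothesis handles the left factor. *)
  obtain v where v: "?y *\<^sub>R (?y *\<^sub>R x + ?Y x) - ?Y (?y *\<^sub>R x + ?Y x) = A v"
    using Suc[of "?y *\<^sub>R x + ?Y x"] by auto
  have "sqrt_iter_bound (Suc n) *\<^sub>R x - sqrt_iter (id_blinfun - A) (Suc n) x
      = (1/2) *\<^sub>R (A x + (?y *\<^sub>R (?y *\<^sub>R x + ?Y x) - ?Y (?y *\<^sub>R x + ?Y x)))"
    by (simp add: blinfun.bilinear_simps algebra_simps power2_eq_square add_divide_distrib)
  also have "\<dots> = A ((1/2) *\<^sub>R (x + v))"
    unfolding v by (simp add: blinfun.bilinear_simps)
  finally show ?case by blast
qed

text \<open>
  The estimate \<open>\<parallel>A x\<parallel>\<^sup>2 \<le> \<langle>x, A x\<rangle>\<close> makes \<open>I - A\<close> a contraction, so the iteration applies to it.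
  The commutation property is what makes the square root complex linear (\<open>T\<close> a complex scalar) and
  unique (\<open>T\<close> another square root); it passes to the limit because each iterate
  is a polynomial in \<open>A\<close>.
\<close>

lemma pos_symmetric_sqrt_exists_contraction:
  fixes A :: "'a::{real_inner,banach} \<Rightarrow> 'a"
  assumes A: "pos_symmetric A" and le: "\<And>x. inner x (A x) \<le> (norm x)\<^sup>2"
  shows "\<exists>S. pos_symmetric S \<and> (\<forall>x. S (S x) = A x) \<and>
    (\<forall>T. bounded_linear T \<longrightarrow> (\<forall>y. T (A y) = A (T y)) \<longrightarrow> (\<forall>x. T (S x) = S (T x))) \<and>
    range S \<subseteq> closure (range A)"
proof -
  have blA: "bounded_linear A" and symA: "\<And>x y. inner x (A y) = inner (A x) y"
    and posA: "\<And>x. 0 \<le> inner x (A x)"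
    using A by (auto simp: pos_symmetric_def)
  define B where "B = id_blinfun - Blinfun A"
  have BA: "B x = x - A x" for x
    by (simp add: B_def blinfun.bilinear_simps bounded_linear_Blinfun_apply[OF blA])
  have "norm (B x) \<le> norm x" for x
  proof -
    have "(norm (B x))\<^sup>2 = (norm x)\<^sup>2 - 2 * inner x (A x) + (norm (A x))\<^sup>2"
      by (simp add: BA power2_norm_eq_inner inner_diff_left inner_diff_right inner_commute)
    also have "\<dots> \<le> (norm x)\<^sup>2"
      using pos_symmetric_norm_square_le[OF A, of 1 x] le posA[of x] by simp
    finally show ?thesis by (rule power2_le_imp_le) simp
  qed
  then have B1: "norm B \<le> 1" by (intro norm_blinfun_bound) auto
  obtain Y where Y: "sqrt_iter B \<longlonglongrightarrow> Y"
    using sqrt_iter_convergent[OF B1] by (auto simp: convergent_def)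
  have Yx: "(\<lambda>n. sqrt_iter B n x) \<longlonglongrightarrow> Y x" for x
    by (intro tendsto_intros Y)
  have "(\<lambda>n. (1/2) *\<^sub>R (B + (sqrt_iter B n o\<^sub>L sqrt_iter B n))) \<longlonglongrightarrow> (1/2) *\<^sub>R (B + (Y o\<^sub>L Y))"
    by (intro tendsto_intros Y)
  moreover have "(\<lambda>n. (1/2) *\<^sub>R (B + (sqrt_iter B n o\<^sub>L sqrt_iter B n))) \<longlonglongrightarrow> Y"
    using LIMSEQ_Suc[OF Y] by simp
  ultimately have fixed_point: "(1/2) *\<^sub>R (B + (Y o\<^sub>L Y)) = Y" by (rule LIMSEQ_unique)
  have YY: "Y (Y x) = 2 *\<^sub>R Y x - x + A x" for x
  proof -
    have "2 *\<^sub>R Y x = 2 *\<^sub>R ((1/2) *\<^sub>R (B + (Y o\<^sub>L Y))) x" by (simp only: fixed_point)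
    also have "\<dots> = x - A x + Y (Y x)"
      by (simp add: blinfun.scaleR_left blinfun.add_left BA)
    finally show ?thesis by simp
  qed
  have nY: "norm Y \<le> 1"
    using norm_sqrt_iter_le[OF B1] sqrt_iter_bound_range
    by (intro LIMSEQ_le_const2[OF tendsto_norm[OF Y]]) (blast intro: order.trans)
  define S where "S x = x - Y x" for x
  have "bounded_linear S"
    unfolding S_def by (intro bounded_linear_sub bounded_linear_ident blinfun.bounded_linear_right)
  moreover have "inner x (S y) = inner (S x) y" for x y
  proof -
    have "inner x (sqrt_iter B n y) = inner (sqrt_iter B n x) y" for n
      by (rule sqrt_iter_symmetric) (simp add: BA inner_diff_left inner_diff_right symA)
    then have "(\<lambda>n. inner (sqrt_iter B n x) y) \<longlonglongrightarrow> inner x (Y y)"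
      using tendsto_inner[OF tendsto_const Yx, of x y] by simp
    then have "inner x (Y y) = inner (Y x) y"
      using tendsto_inner[OF Yx tendsto_const, of x y] LIMSEQ_unique by blast
    then show ?thesis by (simp add: S_def inner_diff_left inner_diff_right)
  qed
  moreover have "0 \<le> inner x (S x)" for x
  proof -
    have "inner x (Y x) \<le> norm x * norm (Y x)" by (rule norm_cauchy_schwarz)
    also have "\<dots> \<le> norm x * (1 * norm x)"
      by (intro mult_left_mono order.trans[OF norm_blinfun] mult_right_mono nY) auto
    finally show ?thesis
      by (simp add: S_def inner_diff_right flip: power2_eq_square power2_norm_eq_inner)
  qed
  ultimately have "pos_symmetric S" by (simp add: pos_symmetric_def)
  moreover have "S (S x) = A x" for x
    by (simp add: S_def blinfun.bilinear_simps YY scaleR_2)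
  moreover have "T (S x) = S (T x)" if T: "bounded_linear T" and TA: "\<And>y. T (A y) = A (T y)" for T x
  proof -
    interpret T: bounded_linear T by fact
    have "T (sqrt_iter B n x) = sqrt_iter B n (T x)" for n
      by (rule sqrt_iter_commute[OF T]) (simp add: BA T.diff TA)
    then have "(\<lambda>n. sqrt_iter B n (T x)) \<longlonglongrightarrow> T (Y x)"
      using T.tendsto[OF Yx[of x]] by simp
    then have "T (Y x) = Y (T x)" using Yx LIMSEQ_unique by blast
    then show ?thesis by (simp add: S_def T.diff)
  qed
  moreover have "range S \<subseteq> closure (range A)"
  proof clarify
    fix x
    have "sqrt_iter_bound n *\<^sub>R x - sqrt_iter B n x \<in> range A" for n
      using sqrt_iter_range[of n x "Blinfun A"]
      by (simp add: B_def bounded_linear_Blinfun_apply[OF blA])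
    moreover have "(\<lambda>n. sqrt_iter_bound n *\<^sub>R x - sqrt_iter B n x) \<longlonglongrightarrow> 1 *\<^sub>R x - Y x"
      by (intro tendsto_intros sqrt_iter_bound_tendsto Yx)
    ultimately show "S x \<in> closure (range A)"
      unfolding closure_sequential S_def
      by (intro exI[of _ "\<lambda>n. sqrt_iter_bound n *\<^sub>R x - sqrt_iter B n x"]) simp
  qed
  ultimately show ?thesis by (intro exI[of _ S] conjI allI impI) simp_all
qed

lemma pos_symmetric_scaleR:
  assumes "pos_symmetric A" "0 \<le> c"
  shows "pos_symmetric (\<lambda>x. c *\<^sub>R A x)"
  using assms by (auto simp: pos_symmetric_def intro: bounded_linear_const_scaleR)

lemma pos_symmetric_sqrt_exists:
  fixes A :: "'a::{real_inner,banach} \<Rightarrow> 'a"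
  assumes A: "pos_symmetric A"
  shows "\<exists>S. pos_symmetric S \<and> (\<forall>x. S (S x) = A x) \<and>
    (\<forall>T. bounded_linear T \<longrightarrow> (\<forall>y. T (A y) = A (T y)) \<longrightarrow> (\<forall>x. T (S x) = S (T x))) \<and>
    range S \<subseteq> closure (range A)"
proof -
  interpret A: bounded_linear A using A by (simp add: pos_symmetric_def)
  obtain M where M: "M > 0" "\<And>x. inner x (A x) \<le> M * (norm x)\<^sup>2"
    using pos_symmetric_form_bound[OF A] by metis
  let ?A = "\<lambda>x. (1 / M) *\<^sub>R A x"
  have 1: "pos_symmetric ?A" using M by (intro pos_symmetric_scaleR A) auto
  have 2: "inner x (?A x) \<le> (norm x)\<^sup>2" for x
    using M by (simp add: field_simps)
  obtain S where S: "pos_symmetric S" "\<And>x. S (S x) = ?A x"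
    "\<And>T. bounded_linear T \<longrightarrow> (\<forall>y. T (?A y) = ?A (T y)) \<longrightarrow> (\<forall>x. T (S x) = S (T x))"
    "range S \<subseteq> closure (range ?A)"
    using pos_symmetric_sqrt_exists_contraction[OF 1 2] by blast
  interpret S: bounded_linear S using S by (simp add: pos_symmetric_def)
  let ?S = "\<lambda>x. sqrt M *\<^sub>R S x"
  have "range ?A \<subseteq> range A" by (intro image_subsetI) (metis A.scaleR rangeI)
  then have "closure (range ?A) \<subseteq> closure (range A)" by (rule closure_mono)
  then have "S x \<in> closure (range A)" for x using S(4) by blast
  then have "range ?S \<subseteq> closure (range A)"
    by (auto simp flip: S.scaleR)
  moreover have "pos_symmetric ?S" using M S by (intro pos_symmetric_scaleR) auto
  moreover have "?S (?S x) = A x" for x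
    using M by (simp add: S.scaleR S(2))
  moreover have "T (?S x) = ?S (T x)" if T: "bounded_linear T" and TA: "\<And>y. T (A y) = A (T y)" for T x
  proof -
    interpret T: bounded_linear T by fact
    have "T (S x) = S (T x)"
      using S(3)[of T] T TA by (simp add: T.scaleR)
    then show ?thesis by (simp add: T.scaleR)
  qed
  ultimately show ?thesis by (intro exI[of _ ?S] conjI allI impI) simp_all
qed

text \<open>
  For \<open>y = (S - B) x\<close>, commutativity gives \<open>(S + B) y = S\<^sup>2 x - B\<^sup>2 x = 0\<close>. Both forms are
  nonnegative, so \<open>S y = B y = 0\<close>, whence \<open>\<langle>y, y\<rangle> = \<langle>x, (S - B) y\<rangle> = 0\<close>.
\<close>

lemma pos_symmetric_sqrt_unique:
  fixes S :: "'a::real_inner \<Rightarrow> 'a"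
  assumes S: "pos_symmetric S" and B: "pos_symmetric B"
    and eq: "\<And>x. S (S x) = B (B x)" and comm: "\<And>x. B (S x) = S (B x)"
  shows "S = B"
proof
  fix x
  interpret S: bounded_linear S using S by (simp add: pos_symmetric_def)
  interpret B: bounded_linear B using B by (simp add: pos_symmetric_def)
  let ?y = "S x - B x"
  have "S ?y + B ?y = 0" by (simp add: S.diff B.diff eq comm)
  then have "inner ?y (S ?y) + inner ?y (B ?y) = 0" by (metis inner_add_right inner_zero_right)
  moreover have "0 \<le> inner ?y (S ?y)" "0 \<le> inner ?y (B ?y)"
    by (rule pos_symmetric_posD S B)+
  ultimately have "inner ?y (S ?y) = 0" "inner ?y (B ?y) = 0" by linarith+
  then have zero: "S ?y = 0" "B ?y = 0"
    using pos_symmetric_form_zero S B by blast+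
  have "inner (S x) ?y = inner x (S ?y)" "inner (B x) ?y = inner x (B ?y)"
    by (simp_all add: pos_symmetric_symD[OF S] pos_symmetric_symD[OF B])
  then have "inner ?y ?y = 0" using zero by (simp add: inner_diff_left)
  then show "S x = B x" by simp
qed

section \<open>Positive operators on complex Hilbert spaces\<close>

lemma cinner_scaleC_left: "cinner (a *\<^sub>C x) y = cnj a * cinner x y"
  by (metis cinner_commute cinner_scaleC_right complex_cnj_mult complex_cnj_cnj)

lemma cinner_add_left: "cinner (x + y) z = cinner x z + cinner y z"
  by (metis cinner_commute cinner_add_right complex_cnj_add)

lemma Im_cinner: "Im (cinner x y) = - inner x (\<i> *\<^sub>C y)"
  by (simp add: cinner_scaleC_right flip: Re_cinner)

lemma norm_scaleC: "norm (a *\<^sub>C x) = cmod a * norm x"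
proof -
  have "(norm (a *\<^sub>C x))\<^sup>2 = Re (cnj a * a * cinner x x)"
    by (simp add: power2_norm_eq_inner cinner_scaleC_left cinner_scaleC_right mult_ac flip: Re_cinner)
  also have "cnj a * a = of_real ((cmod a)\<^sup>2)"
    by (simp only: complex_norm_square mult.commute)
  also have "Re (of_real ((cmod a)\<^sup>2) * cinner x x) = (cmod a * norm x)\<^sup>2"
    by (simp only: Re_complex_of_real times_complex.sel Im_complex_of_real Re_cinner
        power2_norm_eq_inner power_mult_distrib mult_zero_left diff_zero)
  finally show ?thesis by (rule power2_eq_imp_eq) auto
qed

lemma cmod_cinner_le: "cmod (cinner x y) \<le> norm x * norm y"
proof -
  let ?c = "cinner x y"
  have "(cmod ?c)\<^sup>2 = inner x (cnj ?c *\<^sub>C y)"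
    by (simp add: cinner_scaleC_right cmod_power2 flip: power2_eq_square Re_cinner)
  also have "\<dots> \<le> norm x * norm (cnj ?c *\<^sub>C y)" by (rule norm_cauchy_schwarz)
  finally have "cmod ?c * cmod ?c \<le> cmod ?c * (norm x * norm y)"
    by (simp add: norm_scaleC power2_eq_square mult_ac)
  then show ?thesis by (cases "?c = 0") simp_all
qed

lemma bounded_linear_scaleC: "bounded_linear (\<lambda>x::'a::complex_inner. c *\<^sub>C x)"
proof (rule bounded_linear_intro[where K="cmod c"])
  show "c *\<^sub>C (r *\<^sub>R x) = r *\<^sub>R (c *\<^sub>C x)" for r and x :: 'a
    by (simp add: scaleC_scaleC mult.commute flip: scaleC_of_real)
qed (simp_all add: scaleC_add_right norm_scaleC mult.commute)

lemma bounded_linear_ketbra: "bounded_linear (ketbra a b)"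
proof (rule bounded_linear_intro[where K="norm a * norm b"])
  show "norm (ketbra a b x) \<le> norm x * (norm a * norm b)" for x
    using mult_right_mono[OF cmod_cinner_le[of b x], of "norm a"]
    by (simp add: ketbra_def norm_scaleC mult_ac)
qed (simp_all add: ketbra_def cinner_add_right scaleC_add_left cinner_scaleC_right scaleC_scaleC
       flip: scaleC_of_real)

lemma ketbra_scaleC: "ketbra a b (c *\<^sub>C x) = c *\<^sub>C ketbra a b x"
  by (simp add: ketbra_def cinner_scaleC_right scaleC_scaleC)

lemma inner_ketbra: "inner x (ketbra v v y) = Re (cnj (cinner v x) * cinner v y)"
proof -
  have "cinner x (ketbra v v y) = cnj (cinner v x) * cinner v y"
    by (simp add: ketbra_def cinner_scaleC_right cinner_commute[of x v] mult.commute)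
  then show ?thesis by (simp only: flip: Re_cinner)
qed

lemma inner_ketbra_self: "inner x (ketbra v v x) = (cmod (cinner v x))\<^sup>2"
  by (simp add: inner_ketbra cmod_power2 flip: power2_eq_square)

text \<open>
  Polarization: the imaginary part of the form at \<open>x + \<i> y\<close> vanishes, and it equals the
  defect of symmetry of the real inner product. Conversely, symmetry makes the form real.
\<close>

lemma positive_op_iff_pos_symmetric:
  "positive_op A \<longleftrightarrow> pos_symmetric A \<and> (\<forall>c x. A (c *\<^sub>C x) = c *\<^sub>C A x)"
proof
  assume A: "positive_op A"
  then interpret bounded_linear A by (simp add: positive_op_def bounded_clinear_def)
  have A_scaleC: "A (c *\<^sub>C x) = c *\<^sub>C A x" for c x
    using A by (simp add: positive_op_def bounded_clinear_def)
  have form: "Im (cinner x (A x)) = 0" "0 \<le> Re (cinner x (A x))" for x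
    using A by (auto simp: positive_op_def complex_nonneg_Reals_iff)
  have "inner x (A y) = inner (A x) y" for x y
  proof -
    have "Im (cinner (x + \<i> *\<^sub>C y) (A (x + \<i> *\<^sub>C y))) = Re (cinner x (A y)) - Re (cinner y (A x))"
      by (simp add: add A_scaleC cinner_add_left cinner_add_right cinner_scaleC_left
          cinner_scaleC_right form)
    then show ?thesis by (simp add: form Re_cinner inner_commute)
  qed
  with form(2) show "pos_symmetric A \<and> (\<forall>c x. A (c *\<^sub>C x) = c *\<^sub>C A x)"
    by (auto simp: pos_symmetric_def bounded_linear_axioms A_scaleC Re_cinner)
next
  assume A: "pos_symmetric A \<and> (\<forall>c x. A (c *\<^sub>C x) = c *\<^sub>C A x)"
  have "Im (cinner x (A x)) = - Im (cinner x (A x))" for x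
  proof -
    have "Im (cinner x (A x)) = - inner x (A (\<i> *\<^sub>C x))" using A by (simp add: Im_cinner)
    also have "\<dots> = - inner (A x) (\<i> *\<^sub>C x)"
      using pos_symmetric_symD[of A x "\<i> *\<^sub>C x"] A by argo
    also have "\<dots> = Im (cinner (A x) x)" by (simp add: Im_cinner)
    also have "\<dots> = - Im (cinner x (A x))" by (subst cinner_commute) simp
    finally show ?thesis .
  qed
  then show "positive_op A"
    using A by (auto simp: positive_op_def bounded_clinear_def complex_nonneg_Reals_iff
        pos_symmetric_linearD pos_symmetric_posD Re_cinner)
qed

lemma positive_op_cinner:
  assumes "positive_op A"
  shows "cinner x (A y) = cinner (A x) y"
proof (rule complex_eqI)
  have sym: "pos_symmetric A" and A: "A (\<i> *\<^sub>C y) = \<i> *\<^sub>C A y"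
    using assms unfolding positive_op_iff_pos_symmetric by blast+
  show "Re (cinner x (A y)) = Re (cinner (A x) y)"
    using pos_symmetric_symD[OF sym] by (simp add: Re_cinner)
  show "Im (cinner x (A y)) = Im (cinner (A x) y)"
    using pos_symmetric_symD[OF sym, of x "\<i> *\<^sub>C y"] by (simp add: Im_cinner A)
qed

lemma op_sqrt_positive:
  fixes A :: "'a::complex_hilbert \<Rightarrow> 'a"
  assumes A: "positive_op A"
  shows "positive_op (op_sqrt A)" and "op_sqrt A (op_sqrt A x) = A x"
    and "range (op_sqrt A) \<subseteq> closure (range A)"
proof -
  have symA: "pos_symmetric A" and A_scaleC: "\<And>c x. A (c *\<^sub>C x) = c *\<^sub>C A x"
    using A unfolding positive_op_iff_pos_symmetric by auto
  obtain S where S: "pos_symmetric S" and SS: "\<And>x. S (S x) = A x"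
    and comm: "\<And>T. bounded_linear T \<longrightarrow> (\<forall>y. T (A y) = A (T y)) \<longrightarrow> (\<forall>x. T (S x) = S (T x))"
    and ran: "range S \<subseteq> closure (range A)"
    using pos_symmetric_sqrt_exists[OF symA] by blast
  have "S (c *\<^sub>C x) = c *\<^sub>C S x" for c x
    using comm[of "\<lambda>x. c *\<^sub>C x"] by (simp add: bounded_linear_scaleC A_scaleC)
  then have posS: "positive_op S"
    using S by (simp add: positive_op_iff_pos_symmetric)
  moreover have "S \<circ> S = A" using SS by (simp add: fun_eq_iff)
  moreover have "B = S" if B: "positive_op B \<and> B \<circ> B = A" for B
  proof (rule sym, rule pos_symmetric_sqrt_unique[OF S])
    show "pos_symmetric B" using B by (simp add: positive_op_iff_pos_symmetric)
    have BB: "B (B x) = A x" for x using B by (simp add: fun_eq_iff)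
    then show "S (S x) = B (B x)" for x by (simp add: SS)
    have "B (A y) = A (B y)" for y by (simp flip: BB)
    then show "B (S x) = S (B x)" for x
      using comm[of B] B by (simp add: positive_op_def bounded_clinear_def)
  qed
  ultimately have "op_sqrt A = S"
    unfolding op_sqrt_def by (intro the_equality conjI)
  with posS SS ran show "positive_op (op_sqrt A)" "op_sqrt A (op_sqrt A x) = A x"
    "range (op_sqrt A) \<subseteq> closure (range A)" by auto
qed

text \<open>
  Symmetry of the square root moves it from \<open>x\<close> to \<open>v\<close> inside the inner product. In this form the
  recursion telescopes, and square roots of different residuals never have to be compared.
\<close>

lemma Phi_eq_minus_ketbra:
  fixes A :: "'a::complex_hilbert \<Rightarrow> 'a"
  assumes A: "positive_op A"
  shows "Phi v A x = A x - ketbra (op_sqrt A v) (op_sqrt A v) x"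
proof -
  note S = op_sqrt_positive[OF A]
  interpret S: bounded_linear "op_sqrt A"
    using S(1) by (simp add: positive_op_def bounded_clinear_def)
  have "op_sqrt A (c *\<^sub>C x) = c *\<^sub>C op_sqrt A x" for c x
    using S(1) by (simp add: positive_op_def bounded_clinear_def)
  then show ?thesis
    by (simp add: Phi_def S.diff S(2) ketbra_def positive_op_cinner[OF S(1)])
qed

text \<open>
  By the Cauchy--Schwarz inequality for \<open>v\<close> and \<open>A\<^sup>1\<^sup>/\<^sup>2 x\<close>, the form of the rank-one term is
  at most \<open>\<parallel>A\<^sup>1\<^sup>/\<^sup>2 x\<parallel>\<^sup>2 = \<langle>x, A x\<rangle>\<close>.
\<close>

lemma positive_op_Phi:
  fixes A :: "'a::complex_hilbert \<Rightarrow> 'a"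
  assumes A: "positive_op A" and v: "norm v \<le> 1"
  shows "positive_op (Phi v A)"
  unfolding positive_op_iff_pos_symmetric pos_symmetric_def Phi_eq_minus_ketbra[OF A, abs_def]
proof (intro conjI allI)
  let ?S = "op_sqrt A"
  have symA: "pos_symmetric A" and A_scaleC: "\<And>c x. A (c *\<^sub>C x) = c *\<^sub>C A x"
    using A unfolding positive_op_iff_pos_symmetric by auto
  have S: "positive_op ?S" "\<And>x. ?S (?S x) = A x" using op_sqrt_positive[OF A] by auto
  then have symS: "pos_symmetric ?S" by (simp add: positive_op_iff_pos_symmetric)
  show "bounded_linear (\<lambda>x. A x - ketbra (?S v) (?S v) x)"
    by (intro bounded_linear_sub pos_symmetric_linearD[OF symA] bounded_linear_ketbra)
  show "inner x (A y - ketbra (?S v) (?S v) y) = inner (A x - ketbra (?S v) (?S v) x) y" for x y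
    by (simp add: inner_diff_left inner_diff_right pos_symmetric_symD[OF symA, of x y]
        inner_ketbra inner_commute[of "ketbra (?S v) (?S v) x" y] mult.commute)
  show "0 \<le> inner x (A x - ketbra (?S v) (?S v) x)" for x
  proof -
    have "inner x (A x) = (norm (?S x))\<^sup>2"
      using pos_symmetric_symD[OF symS, of x "?S x"] by (simp add: S(2) power2_norm_eq_inner)
    moreover have "cmod (cinner (?S v) x) \<le> norm (?S x)"
      using cmod_cinner_le[of v "?S x"] mult_right_mono[OF v, of "norm (?S x)"]
      by (simp add: positive_op_cinner[OF S(1)])
    ultimately show ?thesis
      by (simp add: inner_diff_right inner_ketbra_self power_mono)
  qed
  show "A (c *\<^sub>C x) - ketbra (?S v) (?S v) (c *\<^sub>C x) = c *\<^sub>C (A x - ketbra (?S v) (?S v) x)" for c x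
    by (simp only: A_scaleC ketbra_scaleC complex_vector.scale_right_diff_distrib)
qed

lemma csubspace_closure:
  assumes "complex_vector.subspace (V :: 'a::complex_inner set)"
  shows "complex_vector.subspace (closure V)"
  unfolding complex_vector.subspace_def
proof (intro conjI ballI allI)
  show "0 \<in> closure V"
    using complex_vector.subspace_0[OF assms] closure_subset by blast
  show "x + y \<in> closure V" if xy: "x \<in> closure V" "y \<in> closure V" for x y
  proof -
    obtain f g where f: "\<And>n. f n \<in> V" "f \<longlonglongrightarrow> x" and g: "\<And>n. g n \<in> V" "g \<longlonglongrightarrow> y"
      using xy unfolding closure_sequential by blast
    have "(\<lambda>n. f n + g n) \<longlonglongrightarrow> x + y" by (intro tendsto_intros f g)
    moreover have "f n + g n \<in> V" for n
      using complex_vector.subspace_add[OF assms f(1) g(1)] .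
    ultimately show ?thesis
      unfolding closure_sequential by (intro exI[of _ "\<lambda>n. f n + g n"]) simp
  qed
  show "c *\<^sub>C x \<in> closure V" if x: "x \<in> closure V" for c x
  proof -
    obtain f where f: "\<And>n. f n \<in> V" "f \<longlonglongrightarrow> x"
      using x unfolding closure_sequential by blast
    have "(\<lambda>n. c *\<^sub>C f n) \<longlonglongrightarrow> c *\<^sub>C x"
      by (rule bounded_linear.tendsto[OF bounded_linear_scaleC f(2)])
    moreover have "c *\<^sub>C f n \<in> V" for n
      using complex_vector.subspace_scale[OF assms f(1)] .
    ultimately show ?thesis
      unfolding closure_sequential by (intro exI[of _ "\<lambda>n. c *\<^sub>C f n"]) simp
  qed
qed

lemma csubspace_range:
  assumes "bounded_clinear A"
  shows "complex_vector.subspace (range A)"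
proof -
  interpret bounded_linear A using assms by (simp add: bounded_clinear_def)
  have A: "A (c *\<^sub>C x) = c *\<^sub>C A x" for c x using assms by (simp add: bounded_clinear_def)
  show ?thesis
    unfolding complex_vector.subspace_def
  proof (intro conjI ballI allI)
    show "0 \<in> range A" by (rule range_eqI[of _ _ 0]) (simp add: zero)
    show "x + y \<in> range A" if xy: "x \<in> range A" "y \<in> range A" for x y
    proof -
      obtain a b where "x = A a" "y = A b" using xy by blast
      then show ?thesis by (intro range_eqI[of _ _ "a + b"]) (simp add: add)
    qed
    show "c *\<^sub>C x \<in> range A" if x: "x \<in> range A" for c x
    proof -
      obtain a where "x = A a" using x by blast
      then show ?thesis by (intro range_eqI[of _ _ "c *\<^sub>C a"]) (simp add: A)
    qed
  qed
qed

lemma sot_lim_eqI: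
  assumes "sot_tendsto A L"
  shows "sot_lim A = L"
  unfolding sot_lim_def
proof (rule the_equality)
  show "L' = L" if "sot_tendsto A L'" for L'
  proof
    fix x
    show "L' x = L x"
      using assms that LIMSEQ_unique[of "\<lambda>n. A n x"] by (auto simp: sot_tendsto_def)
  qed
qed fact

section \<open>The residual operators and their limit\<close>

locale residual_sequence =
  fixes R :: "nat \<Rightarrow> 'a::complex_hilbert \<Rightarrow> 'a" and u E :: "nat \<Rightarrow> 'a"
  assumes positive_R_0: "positive_op (R 0)"
    and norm_u: "norm (u n) = 1"
    and R_Suc_Phi: "R (Suc n) = Phi (u n) (R n)"
    and E_eq: "E n = op_sqrt (R n) (u n)"
begin

lemma positive_R: "positive_op (R n)"
  by (induction n) (simp_all add: positive_R_0 R_Suc_Phi positive_op_Phi norm_u)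

lemma pos_symmetric_R: "pos_symmetric (R n)"
  using positive_R positive_op_iff_pos_symmetric by blast

lemma R_Suc: "R (Suc n) x = R n x - ketbra (E n) (E n) x"
  by (simp add: R_Suc_Phi E_eq Phi_eq_minus_ketbra[OF positive_R])

lemma R_eq_minus_sum: "R n x = R 0 x - (\<Sum>k<n. ketbra (E k) (E k) x)"
  by (induction n) (simp_all add: R_Suc)

lemma inner_R: "inner x (R n x) = inner x (R 0 x) - (\<Sum>k<n. (cmod (cinner (E k) x))\<^sup>2)"
  by (subst R_eq_minus_sum) (simp add: inner_diff_right inner_sum_right inner_ketbra_self)

lemma inner_R_decseq: "decseq (\<lambda>n. inner x (R n x))"
  by (rule decseq_SucI) (simp add: R_Suc inner_diff_right inner_ketbra_self)

lemma pos_symmetric_R_diff: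
  assumes "m \<le> n"
  shows "pos_symmetric (\<lambda>x. R m x - R n x)"
  unfolding pos_symmetric_def
proof (intro conjI allI)
  show "bounded_linear (\<lambda>x. R m x - R n x)"
    by (intro bounded_linear_sub pos_symmetric_linearD pos_symmetric_R)
  show "inner x (R m y - R n y) = inner (R m x - R n x) y" for x y
    by (simp only: inner_diff_left inner_diff_right pos_symmetric_symD[OF pos_symmetric_R])
  show "0 \<le> inner x (R m x - R n x)" for x
    using decseqD[OF inner_R_decseq assms] by (simp add: inner_diff_right)
qed

text \<open>
  All forms are dominated by that of \<open>R 0\<close>, so one constant serves in
  \<open>pos_symmetric_norm_square_le\<close> for every residual and every difference of residuals.
\<close>

lemma R_uniform_bound:
  obtains M where "M > 0" "\<And>x. norm (R 0 x) \<le> M * norm x"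
    "\<And>n x. (norm (R n x))\<^sup>2 \<le> M * inner x (R n x)"
    "\<And>m n x. m \<le> n \<Longrightarrow> (norm (R m x - R n x))\<^sup>2 \<le> M * (inner x (R m x) - inner x (R n x))"
proof -
  obtain M where M: "M > 0" "\<And>x. norm (R 0 x) \<le> M * norm x"
    and R0: "\<And>x. inner x (R 0 x) \<le> M * (norm x)\<^sup>2"
    using pos_symmetric_form_bound[OF pos_symmetric_R] by metis
  have le: "inner x (R n x) \<le> M * (norm x)\<^sup>2" for n x
    using decseqD[OF inner_R_decseq[of x], of 0 n] R0[of x] by simp
  have le': "inner x (R m x - R n x) \<le> M * (norm x)\<^sup>2" for m n x
    using le[of x m] pos_symmetric_posD[OF pos_symmetric_R[of n], of x]
    by (simp add: inner_diff_right)
  have "(norm (R m x - R n x))\<^sup>2 \<le> M * (inner x (R m x) - inner x (R n x))" if "m \<le> n" for m n x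
    using pos_symmetric_norm_square_le[OF pos_symmetric_R_diff[OF that] M(1) le']
    by (simp add: inner_diff_right)
  moreover have "(norm (R n x))\<^sup>2 \<le> M * inner x (R n x)" for n x
    by (rule pos_symmetric_norm_square_le[OF pos_symmetric_R M(1) le])
  ultimately show ?thesis using M that by blast
qed

text \<open>
  The form values decrease and are nonnegative, hence form a Cauchy sequence; the uniform bound
  transfers this to the vectors.
\<close>

lemma R_convergent: "convergent (\<lambda>n. R n x)"
proof -
  obtain M where M: "M > 0"
    "\<And>m n x. m \<le> n \<Longrightarrow> (norm (R m x - R n x))\<^sup>2 \<le> M * (inner x (R m x) - inner x (R n x))"
    using R_uniform_bound by metis
  obtain q where "(\<lambda>n. inner x (R n x)) \<longlonglongrightarrow> q"
    using decseq_convergent[OF inner_R_decseq, of 0] pos_symmetric_posD[OF pos_symmetric_R] by metis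
  then have Cq: "Cauchy (\<lambda>n. inner x (R n x))" by (rule LIMSEQ_imp_Cauchy)
  have "Cauchy (\<lambda>n. R n x)"
  proof (rule CauchyI')
    fix e :: real assume e: "0 < e"
    then have "0 < e\<^sup>2 / M" using M by simp
    then obtain N where N: "\<forall>m\<ge>N. \<forall>n\<ge>N. norm (inner x (R m x) - inner x (R n x)) < e\<^sup>2 / M"
      using CauchyD[OF Cq] by blast
    have "norm (R m x - R n x) < e" if "N \<le> m" "m < n" for m n
    proof -
      have "(norm (R m x - R n x))\<^sup>2 \<le> M * (inner x (R m x) - inner x (R n x))"
        using M(2)[of m n x] that by simp
      also have "\<dots> \<le> M * norm (inner x (R m x) - inner x (R n x))"
        using M(1) by (intro mult_left_mono) auto
      also have "\<dots> < M * (e\<^sup>2 / M)"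
        using M(1) N that by (intro mult_strict_left_mono) auto
      also have "\<dots> = e\<^sup>2" using M(1) by simp
      finally show ?thesis using e by (intro power2_less_imp_less[of _ e]) simp_all
    qed
    then show "\<exists>N. \<forall>m\<ge>N. \<forall>n>m. dist (R m x) (R n x) < e" by (auto simp: dist_norm)
  qed
  then show ?thesis by (simp add: Cauchy_convergent_iff)
qed

lemma sot_tendsto_R: "sot_tendsto R (sot_lim R)"
proof -
  obtain L where L: "\<And>x. (\<lambda>n. R n x) \<longlonglongrightarrow> L x"
    using R_convergent unfolding convergent_def by metis
  obtain M where M: "M > 0" "\<And>n x. (norm (R n x))\<^sup>2 \<le> M * inner x (R n x)"
    using R_uniform_bound by metis
  have R_le: "norm (R n x) \<le> M * norm x" for n x
  proof -
    have "norm (R n x) * norm (R n x) \<le> M * inner x (R n x)"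
      using M(2)[of n x] by (simp add: power2_eq_square)
    also have "\<dots> \<le> M * (norm x * norm (R n x))"
      using M(1) by (intro mult_left_mono norm_cauchy_schwarz) auto
    finally have "norm (R n x) * norm (R n x) \<le> (M * norm x) * norm (R n x)"
      by (simp add: mult_ac)
    then show ?thesis using M(1) by (cases "norm (R n x) = 0") auto
  qed
  have lin: "bounded_linear (R n)" for n by (rule pos_symmetric_linearD[OF pos_symmetric_R])
  have R_scaleC: "R n (c *\<^sub>C x) = c *\<^sub>C R n x" for n c x
    using positive_R by (simp add: positive_op_iff_pos_symmetric)
  have L_scaleC: "L (c *\<^sub>C x) = c *\<^sub>C L x" for c x
  proof (rule LIMSEQ_unique[OF L])
    show "(\<lambda>n. R n (c *\<^sub>C x)) \<longlonglongrightarrow> c *\<^sub>C L x"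
      unfolding R_scaleC by (rule bounded_linear.tendsto[OF bounded_linear_scaleC L])
  qed
  have "bounded_linear L"
  proof (rule bounded_linear_intro[where K=M])
    show "L (x + y) = L x + L y" for x y
    proof (rule LIMSEQ_unique[OF L])
      show "(\<lambda>n. R n (x + y)) \<longlonglongrightarrow> L x + L y"
        using tendsto_add[OF L L] by (simp add: linear_add bounded_linear.linear[OF lin])
    qed
    show "L (r *\<^sub>R x) = r *\<^sub>R L x" for r x
      using L_scaleC[of "complex_of_real r" x] by (simp only: scaleC_of_real)
    show "norm (L x) \<le> norm x * M" for x
      by (rule LIMSEQ_le_const2[OF tendsto_norm[OF L]]) (use R_le in \<open>auto simp: mult.commute\<close>)
  qed
  with L L_scaleC have "sot_tendsto R L" by (simp add: sot_tendsto_def bounded_clinear_def)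
  then show ?thesis using sot_lim_eqI[of R L] by simp
qed

lemma R_tendsto_sot_lim: "(\<lambda>n. R n x) \<longlonglongrightarrow> sot_lim R x"
  using sot_tendsto_R by (simp add: sot_tendsto_def)

text \<open>
  The residual form is the defect in the sum formula at \<open>x\<close>, so the formula holds exactly
  when the limiting form vanishes at \<open>x\<close>, and for a positive limit this means that the
  limit operator itself vanishes at \<open>x\<close>.
\<close>

lemma sot_lim_eq_0_iff: "sot_lim R x = 0 \<longleftrightarrow>
  (\<lambda>n. complex_of_real ((cmod (cinner (E n) x))\<^sup>2)) sums cinner x (R 0 x)"
proof -
  obtain M where M: "M > 0" "\<And>n x. (norm (R n x))\<^sup>2 \<le> M * inner x (R n x)"
    using R_uniform_bound by metis
  have form_lim: "(\<lambda>n. inner x (R n x)) \<longlonglongrightarrow> inner x (sot_lim R x)"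
    by (intro tendsto_intros R_tendsto_sot_lim)
  have "sot_lim R x = 0 \<longleftrightarrow> inner x (sot_lim R x) = 0"
  proof
    assume zero: "inner x (sot_lim R x) = 0"
    have "(norm (sot_lim R x))\<^sup>2 \<le> M * inner x (sot_lim R x)"
      using M(2) by (intro LIMSEQ_le[OF tendsto_power[OF tendsto_norm[OF R_tendsto_sot_lim]]
            tendsto_mult[OF tendsto_const form_lim]]) auto
    then show "sot_lim R x = 0" using zero by simp
  qed simp
  also have "\<dots> \<longleftrightarrow> (\<lambda>n. inner x (R n x)) \<longlonglongrightarrow> 0"
    using form_lim LIMSEQ_unique[OF form_lim, of 0] by auto
  also have "\<dots> \<longleftrightarrow> (\<lambda>n. \<Sum>k<n. (cmod (cinner (E k) x))\<^sup>2) \<longlonglongrightarrow> inner x (R 0 x)"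
  proof
    assume "(\<lambda>n. inner x (R n x)) \<longlonglongrightarrow> 0"
    from tendsto_diff[OF tendsto_const[of "inner x (R 0 x)"] this]
    show "(\<lambda>n. \<Sum>k<n. (cmod (cinner (E k) x))\<^sup>2) \<longlonglongrightarrow> inner x (R 0 x)"
      by (subst (asm) inner_R) simp
  next
    assume "(\<lambda>n. \<Sum>k<n. (cmod (cinner (E k) x))\<^sup>2) \<longlonglongrightarrow> inner x (R 0 x)"
    from tendsto_diff[OF tendsto_const[of "inner x (R 0 x)"] this]
    show "(\<lambda>n. inner x (R n x)) \<longlonglongrightarrow> 0"
      by (subst inner_R) simp
  qed
  also have "\<dots> \<longleftrightarrow> (\<lambda>n. (cmod (cinner (E n) x))\<^sup>2) sums inner x (R 0 x)"
    by (simp add: sums_def)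
  also have "\<dots> \<longleftrightarrow> (\<lambda>n. complex_of_real ((cmod (cinner (E n) x))\<^sup>2)) sums
      complex_of_real (inner x (R 0 x))"
    by (rule sums_of_real_iff[symmetric])
  also have "complex_of_real (inner x (R 0 x)) = cinner x (R 0 x)"
    using positive_R_0 by (auto simp: positive_op_def complex_nonneg_Reals_iff complex_eq_iff Re_cinner)
  finally show ?thesis .
qed

section \<open>The closed span of the vectors\<close>

abbreviation "sqrt_range \<equiv> closure (range (op_sqrt (R 0)))"

abbreviation "E_span \<equiv> closure (cspan (range E))"

lemma csubspace_sqrt_range: "complex_vector.subspace sqrt_range"
  using op_sqrt_positive(1)[OF positive_R_0]
  by (intro csubspace_closure csubspace_range) (simp add: positive_op_def)

text \<open>
  Simultaneous induction: \<open>E n\<close> is in the range of the square root of \<open>R n\<close>, hence in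
  the closure of the range of \<open>R n\<close>, and passing to \<open>R (Suc n)\<close> only subtracts a multiple of \<open>E n\<close>.
\<close>

lemma R_in_sqrt_range: "R n x \<in> sqrt_range" and E_in_sqrt_range: "E n \<in> sqrt_range"
proof -
  have R_sub: "range (R n) \<subseteq> sqrt_range \<Longrightarrow> E n \<in> sqrt_range" for n
  proof -
    assume "range (R n) \<subseteq> sqrt_range"
    then have "closure (range (R n)) \<subseteq> sqrt_range" by (simp add: closure_minimal)
    then show "E n \<in> sqrt_range" unfolding E_eq using op_sqrt_positive(3)[OF positive_R] by blast
  qed
  have ran: "range (R n) \<subseteq> sqrt_range" for n
  proof (induction n)
    case 0
    have "R 0 x \<in> range (op_sqrt (R 0))" for x
      using op_sqrt_positive(2)[OF positive_R_0, of x] by (metis rangeI)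
    then show ?case using closure_subset by blast
  next
    case (Suc n)
    have "R (Suc n) x \<in> sqrt_range" for x
      unfolding R_Suc ketbra_def
      by (intro complex_vector.subspace_diff[OF csubspace_sqrt_range] complex_vector.subspace_scale[OF csubspace_sqrt_range]
          R_sub Suc) (use Suc in blast)
    then show ?case by blast
  qed
  then show "R n x \<in> sqrt_range" by blast
  show "E n \<in> sqrt_range" by (rule R_sub[OF ran])
qed

lemma E_span_subset_sqrt_range: "E_span \<subseteq> sqrt_range"
proof (rule closure_minimal)
  show "cspan (range E) \<subseteq> sqrt_range"
    by (rule complex_vector.span_minimal[OF _ csubspace_sqrt_range]) (use E_in_sqrt_range in blast)
qed simp

lemma sum_ketbra_tendsto:
  "(\<lambda>n. \<Sum>k<n. ketbra (E k) (E k) x) \<longlonglongrightarrow> R 0 x - sot_lim R x"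
  using tendsto_diff[OF tendsto_const R_tendsto_sot_lim, of "R 0 x" x]
  by (subst (asm) R_eq_minus_sum) simp

text \<open>
  If the residuals vanish in the limit, then \<open>R 0 x\<close> is the sum of the \<open>\<langle>E k, x\<rangle> E k\<close>, so the
  range of \<open>R 0\<close> lies in the closed span; and it is dense in the range of the square root.
\<close>

lemma sqrt_range_subset_E_span:
  assumes "\<And>x. sot_lim R x = 0"
  shows "sqrt_range \<subseteq> E_span"
proof -
  have "R 0 x \<in> E_span" for x
  proof -
    have "(\<Sum>k<n. ketbra (E k) (E k) x) \<in> cspan (range E)" for n
      unfolding ketbra_def
      by (intro complex_vector.span_sum complex_vector.span_scale complex_vector.span_base rangeI)
    then show ?thesis
      using sum_ketbra_tendsto[of x] assms unfolding closure_sequential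
      by (intro exI[of _ "\<lambda>n. \<Sum>k<n. ketbra (E k) (E k) x"]) simp
  qed
  then have "closure (range (R 0)) \<subseteq> E_span" by (intro closure_minimal) auto
  then show ?thesis
    using op_sqrt_positive(3)[OF positive_R_0] by (intro closure_minimal) auto
qed

text \<open>
  The limit maps into the closed range space. So, for \<open>y = sot_lim R x\<close>, the hypothesis applies
  to \<open>y\<close> itself, and symmetry gives \<open>\<langle>y, y\<rangle> = lim \<langle>R n y, x\<rangle> = 0\<close>.
\<close>

lemma sot_lim_eq_0_if_on_sqrt_range:
  assumes "\<And>y. y \<in> sqrt_range \<Longrightarrow> sot_lim R y = 0"
  shows "sot_lim R x = 0"
proof -
  let ?y = "sot_lim R x"
  have "?y \<in> sqrt_range"
    by (rule closed_sequentially[OF closed_closure R_in_sqrt_range R_tendsto_sot_lim])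
  then have "(\<lambda>n. inner (R n ?y) x) \<longlonglongrightarrow> inner 0 x"
    using R_tendsto_sot_lim[of ?y] assms by (intro tendsto_inner tendsto_const) simp
  moreover have "(\<lambda>n. inner ?y (R n x)) \<longlonglongrightarrow> inner ?y ?y"
    by (intro tendsto_intros R_tendsto_sot_lim)
  ultimately have "inner ?y ?y = inner 0 x"
    unfolding pos_symmetric_symD[OF pos_symmetric_R] by (rule LIMSEQ_unique[rotated])
  then show ?thesis by simp
qed

lemma bessel_sequence_E: "bessel_sequence E"
proof -
  obtain M where M: "\<And>x. norm (R 0 x) \<le> M * norm x" using R_uniform_bound by metis
  have le: "(\<Sum>k<n. (cmod (cinner (E k) x))\<^sup>2) \<le> M * (norm x)\<^sup>2" for n x
  proof -
    have "(\<Sum>k<n. (cmod (cinner (E k) x))\<^sup>2) \<le> inner x (R 0 x)"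
      using inner_R[of x n] pos_symmetric_posD[OF pos_symmetric_R[of n], of x] by simp
    also have "\<dots> \<le> norm x * norm (R 0 x)" by (rule norm_cauchy_schwarz)
    also have "\<dots> \<le> norm x * (M * norm x)" by (intro mult_left_mono M) simp
    finally show ?thesis by (simp add: power2_eq_square mult_ac)
  qed
  have "summable (\<lambda>n. (cmod (cinner (E n) x))\<^sup>2)" for x
    by (rule summableI_nonneg_bounded[OF _ le]) simp
  then show ?thesis
    unfolding bessel_sequence_def using suminf_le_const[OF _ le] by blast
qed

lemma frame_operator_E:
  assumes "\<And>x. sot_lim R x = 0"
  shows "frame_operator E = R 0"
  unfolding frame_operator_def
proof (rule sot_lim_eqI)
  show "sot_tendsto (\<lambda>N x. \<Sum>n<N. ketbra (E n) (E n) x) (R 0)"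
    using positive_R_0 sum_ketbra_tendsto assms by (simp add: sot_tendsto_def positive_op_def)
qed

end

section \<open>The equivalence\<close>

theorem theorem3p7:
  fixes R0 :: "'a::complex_hilbert \<Rightarrow> 'a"
    and u :: "nat \<Rightarrow> 'a"
    and R :: "nat \<Rightarrow> 'a \<Rightarrow> 'a"
    and E :: "nat \<Rightarrow> 'a"
    and R_inf :: "'a \<Rightarrow> 'a"
    and K EE :: "'a set"
  assumes "positive_op R0"
    and "\<And>n. norm (u n) = 1"
    and "R 0 = R0"
    and "\<And>n. R (Suc n) = Phi (u n) (R n)"
    and "\<And>n. E n = op_sqrt (R n) (u n)"
  defines "R_inf \<equiv> sot_lim R"
    and "K \<equiv> closure (range (op_sqrt R0))"
    and "EE \<equiv> closure (cspan (range E))"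
  shows "(R_inf = (\<lambda>x. 0) \<longleftrightarrow>
          (\<forall>x. (\<lambda>n. complex_of_real ((cmod (cinner (E n) x))\<^sup>2)) sums cinner x (R0 x)))
       \<and> ((\<forall>x. (\<lambda>n. complex_of_real ((cmod (cinner (E n) x))\<^sup>2)) sums cinner x (R0 x)) \<longleftrightarrow>
          (EE = K \<and>
           (\<forall>x\<in>K. (\<lambda>n. complex_of_real ((cmod (cinner (E n) x))\<^sup>2)) sums cinner x (R0 x))))
       \<and> (R_inf = (\<lambda>x. 0) \<longrightarrow>
          EE = K \<and> bessel_sequence E \<and> frame_operator E = R0)"
proof -
  interpret residual_sequence R u E
    by unfold_locales (simp_all add: assms(1-5))
  have sums_iff: "(\<lambda>n. complex_of_real ((cmod (cinner (E n) x))\<^sup>2)) sums cinner x (R0 x)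
      \<longleftrightarrow> R_inf x = 0" for x
    using sot_lim_eq_0_iff[of x] by (simp add: R_inf_def assms(3))
  have on_K: "R_inf x = 0" if "\<And>y. y \<in> K \<Longrightarrow> R_inf y = 0" for x
    using sot_lim_eq_0_if_on_sqrt_range that by (simp add: R_inf_def K_def assms(3))
  have "EE = K \<and> frame_operator E = R0" if "\<forall>x. R_inf x = 0"
    using that E_span_subset_sqrt_range sqrt_range_subset_E_span frame_operator_E
    by (simp add: R_inf_def K_def EE_def assms(3) subset_antisym)
  then show ?thesis
    unfolding sums_iff fun_eq_iff using on_K bessel_sequence_E by blast
qed

end
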